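(* Let $a,b,c$ be complex numbers and let $(g(x),xg(x))$ be the Bell pseudo-involution whose $B$-sequence has generating function $$B(x)=\frac{a-cx}{1+bx}.$$ Let $A(x)$ be the generating function of the $A$-sequence of $(g(x),xg(x))$. Then, as formal power series, $$A(x)=1+ax-\frac{x^3(ab+c)}{1+ax+bx^2}\, C\left(\frac{x^3(ab+c)}{(1+ax+bx^2)^2}\right)$$ and $$g(x)=\frac{1}{1-ax-bx^2}\,C\left(\frac{-x^2(b+cx)}{(1-ax-bx^2)^2}\right),$$ where $C(x)=\frac{1-\sqrt{1-4x}}{2x}=\sum_{n\ge 0}\frac{1}{n+1}\binom{2n}{n}x^n$ is the generating function of the Catalan numbers.
   Context: All power series are formal, with complex coefficients. The symbol $c$ is a scalar parameter; $C(\cdot)$ is the Catalan generating function. Riordan arrays: for $g(x)=1+g_1x+\cdots$ and $f(x)=f_1x+f_2x^2+\cdots$ with $f_1\neq 0$, the Riordan array $(g(x),f(x))$ is the infinite lower triangular matrix with entries $t_{n,k}=[x^n]\,g(x)f(x)^k$, $n,k\ge 0$. The product of Riordan arrays is $(g,f)\cdot(u,v)=(g(x)u(f(x)),v(f(x)))$, and the identity is $(1,x)$. A Bell array is a Riordan array of the form $(g(x),xg(x))$ with $g(0)=1$. It is a Bell pseudo-involution if $(g(x),-xg(x))^2=(1,x)$. $A$-sequence: the generating function of the $A$-sequence of $(g(x),f(x))$ is $A(x)=x/\bar f(x)$, where $\bar f$ is the compositional inverse of $f$; here $f(x)=xg(x)$. $B$-sequence: the $B$-sequence of a Bell pseudo-involution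 $(g(x),xg(x))$ with entries $t_{n,k}$ is the sequence $b_0,b_1,b_2,\ldots$ such that, for all $n,k\ge 0$, $$t_{n+1,k}=t_{n,k-1}+\sum_{j\ge 0} b_j\, t_{n-j,k+j},$$ where $t_{n,-1}=0$ and $t_{m,l}=0$ whenever $m<0$ or $l>m$. Its generating function is $B(x)=\sum_{j\ge0} b_jx^j$. *)

theory Defs
  imports Complex_Main "HOL-Computational_Algebra.Formal_Power_Series"
begin

text \<open>
  A Riordan array is given by its pair of generating functions \<open>(g, f)\<close>; this loses nothing,
  since the matrix determines the pair (see \<open>riordan_entry_inject\<close> below).
\<close>

type_synonym 'a riordan = "'a fps \<times> 'a fps"

definition is_riordan :: "'a::field riordan \<Rightarrow> bool" where
  "is_riordan = (\<lambda>(g, f). fps_nth g 0 = 1 \<and> fps_nth f 0 = 0 \<and> fps_nth f 1 \<noteq> 0)"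

definition riordan_entry :: "'a::field riordan \<Rightarrow> nat \<Rightarrow> nat \<Rightarrow> 'a" where
  "riordan_entry = (\<lambda>(g, f) n k. fps_nth (g * f ^ k) n)"

definition riordan_mult :: "'a::field riordan \<Rightarrow> 'a riordan \<Rightarrow> 'a riordan" where
  "riordan_mult = (\<lambda>(g, f) (u, v). (g * (u oo f), v oo f))"

definition riordan_one :: "'a::field riordan" where
  "riordan_one = (1, fps_X)"

definition bell_array :: "'a::field fps \<Rightarrow> 'a riordan" where
  "bell_array g = (g, fps_X * g)"

definition bell_pseudo_involution :: "'a::field fps \<Rightarrow> bool" where
  "bell_pseudo_involution g \<longleftrightarrow>
     fps_nth g 0 = 1 \<and>
     riordan_mult (g, - (fps_X * g)) (g, - (fps_X * g)) = riordan_one"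

definition A_gf :: "'a::field riordan \<Rightarrow> 'a fps" where
  "A_gf = (\<lambda>(g, f). fps_X / fps_inv f)"

text \<open>
  Terms \<open>b j * t (n - j) (k + j)\<close> with \<open>j > n\<close> have a negative row index and are therefore left out
  of the sum (natural number subtraction would truncate). Entries above the diagonal are already
  \<open>0\<close> by \<open>riordan_entry_eq_0\<close>.
\<close>

definition is_B_sequence :: "'a::field riordan \<Rightarrow> (nat \<Rightarrow> 'a) \<Rightarrow> bool" where
  "is_B_sequence R b \<longleftrightarrow>
     (\<forall>n k. riordan_entry R (n + 1) k =
        (if k = 0 then 0 else riordan_entry R n (k - 1)) +
        (\<Sum>j\<le>n. b j * riordan_entry R (n - j) (k + j)))"

definition catalan_fps :: "'a::field_char_0 fps" where
  "catalan_fps = Abs_fps (\<lambda>n. of_nat ((2 * n) choose n) / of_nat (n + 1))"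

lemma riordan_entry_eq_0:
  assumes "is_riordan R" "n < k"
  shows "riordan_entry R n k = 0"
proof -
  obtain g f where R: "R = (g, f)" by (cases R)
  have f0: "fps_nth f 0 = 0" using assms(1) by (simp add: is_riordan_def R)
  have "fps_nth (f ^ k) i = 0" if "i \<le> n" for i
    using startsby_zero_power_prefix[OF f0] that assms(2) by auto
  then show ?thesis by (simp add: riordan_entry_def R fps_mult_nth)
qed

lemma is_riordan_bell_array:
  "fps_nth g 0 = 1 \<Longrightarrow> is_riordan (bell_array g)"
  by (simp add: is_riordan_def bell_array_def)

lemma riordan_entry_mult:
  assumes "is_riordan R" "is_riordan S"
  shows "riordan_entry (riordan_mult R S) n k =
           (\<Sum>j\<le>n. riordan_entry R n j * riordan_entry S j k)"
proof -
  obtain g f where R: "R = (g, f)" by (cases R)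
  obtain u v where S: "S = (u, v)" by (cases S)
  have f0: "fps_nth f 0 = 0" using assms(1) by (simp add: is_riordan_def R)
  have z: "fps_nth (f ^ j) i = 0" if "i < j" for i j
    using startsby_zero_power_prefix[OF f0] that by auto
  define h where "h = u * v ^ k"
  have "fps_nth (g * (h oo f)) n = (\<Sum>i=0..n. fps_nth g i * (\<Sum>j=0..n-i. fps_nth h j * fps_nth (f ^ j) (n - i)))"
    by (simp add: fps_mult_nth fps_compose_nth)
  also have "\<dots> = (\<Sum>i=0..n. fps_nth g i * (\<Sum>j=0..n. fps_nth h j * fps_nth (f ^ j) (n - i)))"
  proof -
    have "(\<Sum>j=0..n-i. fps_nth h j * fps_nth (f ^ j) (n - i)) =
        (\<Sum>j=0..n. fps_nth h j * fps_nth (f ^ j) (n - i))" for i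
      by (rule sum.mono_neutral_left) (auto simp: z)
    then show ?thesis by simp
  qed
  also have "\<dots> = (\<Sum>i=0..n. \<Sum>j=0..n. fps_nth g i * fps_nth (f ^ j) (n - i) * fps_nth h j)"
    by (simp add: sum_distrib_left mult_ac)
  also have "\<dots> = (\<Sum>j=0..n. \<Sum>i=0..n. fps_nth g i * fps_nth (f ^ j) (n - i) * fps_nth h j)"
    by (rule sum.swap)
  also have "\<dots> = (\<Sum>j=0..n. fps_nth (g * f ^ j) n * fps_nth h j)"
    by (simp add: fps_mult_nth sum_distrib_right)
  finally have "fps_nth (g * (h oo f)) n = (\<Sum>j\<le>n. fps_nth (g * f ^ j) n * fps_nth h j)"
    by (simp add: atLeast0AtMost)
  moreover have "h oo f = (u oo f) * (v oo f) ^ k"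
    by (simp add: h_def fps_compose_mult_distrib[OF f0] fps_compose_power[OF f0])
  ultimately show ?thesis
    by (simp add: riordan_entry_def riordan_mult_def R S h_def mult.assoc)
qed

lemma riordan_entry_inject:
  assumes "is_riordan R" "is_riordan S"
  shows "riordan_entry R = riordan_entry S \<longleftrightarrow> R = S"
proof
  obtain g f where R: "R = (g, f)" by (cases R)
  obtain u v where S: "S = (u, v)" by (cases S)
  assume "riordan_entry R = riordan_entry S"
  then have eq: "fps_nth (g * f ^ k) n = fps_nth (u * v ^ k) n" for n k
    by (metis (no_types, lifting) R S case_prod_conv riordan_entry_def)
  have "g = u" using eq[of 0] by (simp add: fps_eq_iff)
  moreover have "g * f = u * v" using eq[of 1] by (simp add: fps_eq_iff)
  moreover have "g \<noteq> 0" using assms(1) by (auto simp: R is_riordan_def)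
  ultimately show "R = S" by (simp add: R S)
qed simp

lemma catalan_fps_nth_0: "fps_nth catalan_fps 0 = 1"
  by (simp add: catalan_fps_def)

text \<open>
  \<open>1 - 2xC(x)\<close> is the square root of \<open>1 - 4x\<close> with constant term \<open>1\<close>, that is,
  \<open>C(x) = (1 - sqrt (1 - 4x)) / (2x)\<close>.
\<close>

lemma catalan_fps_sqrt:
  "(1 - 2 * fps_X * catalan_fps) ^ 2 = (1 - 4 * fps_X :: 'a::field_char_0 fps)"
proof -
  define S :: "'a fps" where "S = 1 - 2 * fps_X * catalan_fps"
  have rec: "of_nat (n + 2) * fps_nth catalan_fps (n + 1) =
      (of_nat (4 * n + 2) :: 'a) * fps_nth catalan_fps n" for n
  proof -
    have "(n + 1) * ((2 * (n + 1)) choose (n + 1)) = 2 * (2 * n + 1) * ((2 * n) choose n)"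
    proof -
      have "Suc n * (Suc (Suc (2 * n)) choose Suc n) = Suc (Suc (2 * n)) * (Suc (2 * n) choose n)"
        by (rule Suc_times_binomial)
      moreover have "Suc n * (Suc (2 * n) choose n) = Suc (2 * n) * ((2 * n) choose n)"
        using Suc_times_binomial[of n "2 * n"] binomial_symmetric[of n "Suc (2 * n)"]
        by (simp del: binomial_Suc_Suc)
      ultimately have "Suc n * (Suc n * (Suc (Suc (2 * n)) choose Suc n)) =
          Suc n * (2 * (Suc (2 * n) * ((2 * n) choose n)))"
        by (metis (no_types, lifting) mult.left_commute mult_2 mult_Suc_right add_Suc_right add_Suc mult.assoc)
      then show ?thesis by (simp only: mult_cancel1) simp
    qed
    then have "(of_nat (n + 1) :: 'a) * of_nat ((2 * (n + 1)) choose (n + 1)) =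
        of_nat (4 * n + 2) * of_nat ((2 * n) choose n)"
      by (simp only: flip: of_nat_mult) simp
    moreover have "(of_nat (n + 1) :: 'a) \<noteq> 0"
      by (simp del: of_nat_add of_nat_Suc)
    ultimately have "of_nat ((2 * (n + 1)) choose (n + 1)) =
        (of_nat (4 * n + 2) :: 'a) * (of_nat ((2 * n) choose n) / of_nat (n + 1))"
      by (metis nonzero_mult_div_cancel_left times_divide_eq_right)
    moreover have "(of_nat (n + 2) :: 'a) \<noteq> 0"
      by (simp del: of_nat_add of_nat_Suc)
    ultimately show ?thesis
      by (simp only: catalan_fps_def fps_nth_Abs_fps add.assoc one_add_one)
        (simp del: of_nat_add of_nat_mult of_nat_Suc binomial_Suc_Suc)
  qed
  have S: "fps_nth S n = (if n = 0 then 1 else - 2 * fps_nth catalan_fps (n - 1))" for n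
    by (cases n) (simp_all add: S_def mult.assoc numeral_fps_const)
  have S_rec: "of_nat (n + 1) * fps_nth S (n + 1) = (4 * of_nat n - 2) * fps_nth S n" for n
  proof (cases n)
    case (Suc m)
    then show ?thesis using rec[of m] by (simp add: S algebra_simps)
  qed (simp add: S catalan_fps_nth_0)
  have nth_ode: "fps_nth ((1 - 4 * fps_X) * fps_deriv F) n =
      of_nat (n + 1) * fps_nth F (n + 1) - 4 * of_nat n * fps_nth F n" for F :: "'a fps" and n
    by (cases n) (simp_all add: left_diff_distrib mult.assoc numeral_fps_const)
  have ode_S: "(1 - 4 * fps_X) * fps_deriv S = - 2 * S"
    by (rule fps_ext) (simp only: nth_ode S_rec, simp add: algebra_simps numeral_fps_const)
  have "(1 - 4 * fps_X) * fps_deriv (S ^ 2) = 2 * S * ((1 - 4 * fps_X) * fps_deriv S)"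
    by (simp add: power2_eq_square algebra_simps)
  also have "\<dots> = - 4 * S ^ 2"
    unfolding ode_S by (simp add: power2_eq_square)
  finally have ode_Q: "(1 - 4 * fps_X) * fps_deriv (S ^ 2) = fps_const (- 4) * S ^ 2"
    by (simp add: numeral_fps_const)
  have Q_rec: "of_nat (n + 1) * fps_nth (S ^ 2) (n + 1) = (4 * of_nat n - 4) * fps_nth (S ^ 2) n" for n
  proof -
    have "of_nat (n + 1) * fps_nth (S ^ 2) (n + 1) - 4 * of_nat n * fps_nth (S ^ 2) n =
        - 4 * fps_nth (S ^ 2) n"
      unfolding nth_ode[symmetric] ode_Q fps_mult_left_const_nth ..
    then show ?thesis by (simp add: algebra_simps)
  qed
  have Q0: "fps_nth (S ^ 2) 0 = 1" by (simp add: S power2_eq_square)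
  have Q1: "fps_nth (S ^ 2) 1 = - 4" using Q_rec[of 0] by (simp add: Q0)
  have Q2: "fps_nth (S ^ 2) (n + 2) = 0" for n
  proof (induction n)
    case 0
    show ?case using Q_rec[of 1] by simp
  next
    case (Suc n)
    have "(of_nat (n + 3) :: 'a) \<noteq> 0" by (simp del: of_nat_add of_nat_Suc)
    then show ?case using Q_rec[of "n + 2"] Suc by (simp add: numeral_3_eq_3)
  qed
  have "fps_nth (S ^ 2) n = fps_nth (1 - 4 * fps_X) n" for n
  proof -
    consider "n = 0" | "n = 1" | m where "n = m + 2"
      by (metis One_nat_def add_2_eq_Suc' not0_implies_Suc)
    then show ?thesis
      by cases (simp_all add: Q0 Q1 Q2 del: One_nat_def add_2_eq_Suc' add: numeral_fps_const)
  qed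
  then show ?thesis unfolding S_def by (rule fps_ext)
qed

end

theory Submission
  imports Defs
begin

text \<open>
  Column 0 of the \<open>B\<close>-sequence recurrence says \<open>g = 1 + x g B(x\<^sup>2 g)\<close>. For the given \<open>B\<close> this is a
  quadratic equation for \<open>g\<close>. Substituting the compositional inverse of \<open>x g\<close> for \<open>x\<close> turns it
  into a quadratic equation for \<open>A\<close>. Rescaling gives \<open>h = 1 + s h\<^sup>2\<close> in the case of \<open>g\<close>, and
  \<open>t = s + t\<^sup>2\<close> with \<open>t(0) = 0\<close> in the case of \<open>A\<close>. When \<open>s(0) = 0\<close>, their only power series
  solutions are \<open>h = C(s)\<close> and \<open>t = s C(s)\<close>.
\<close>

text \<open>The action of a Riordan array on a column, for any \<open>u\<close> without constant
  term. This generality is needed for \<open>u = fps_X ^ 2 * g\<close>, whose linear coefficient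
  vanishes.\<close>

lemma fps_mult_compose_nth:
  fixes g h u :: "'a::field fps"
  assumes "fps_nth u 0 = 0"
  shows "fps_nth (g * (h oo u)) n = (\<Sum>j\<le>n. fps_nth h j * fps_nth (g * u ^ j) n)"
proof -
  have "(\<Sum>j=0..n-i. fps_nth h j * fps_nth (u ^ j) (n - i)) =
      (\<Sum>j=0..n. fps_nth h j * fps_nth (u ^ j) (n - i))" for i
    by (rule sum.mono_neutral_left) (auto simp: startsby_zero_power_prefix[OF assms])
  then have "fps_nth (g * (h oo u)) n =
      (\<Sum>i=0..n. \<Sum>j=0..n. fps_nth g i * (fps_nth h j * fps_nth (u ^ j) (n - i)))"
    by (simp add: fps_mult_nth fps_compose_nth sum_distrib_left)
  also have "\<dots> = (\<Sum>j=0..n. \<Sum>i=0..n. fps_nth g i * (fps_nth h j * fps_nth (u ^ j) (n - i)))"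
    by (rule sum.swap)
  also have "\<dots> = (\<Sum>j\<le>n. fps_nth h j * fps_nth (g * u ^ j) n)"
    by (simp add: fps_mult_nth sum_distrib_left mult_ac atLeast0AtMost)
  finally show ?thesis .
qed

text \<open>The entry in row \<open>m - j\<close> and column \<open>j\<close> is the coefficient of
  \<open>g * (fps_X ^ 2 * g) ^ j\<close> at \<open>m\<close>, so the sum in the recurrence is a
  coefficient of \<open>g\<close> times a composition with \<open>fps_X ^ 2 * g\<close>.\<close>

lemma bell_B_sequence_functional_eq:
  fixes g :: "'a::field fps"
  assumes g0: "fps_nth g 0 = 1" and B: "is_B_sequence (bell_array g) \<beta>"
  shows "g = 1 + fps_X * (g * (Abs_fps \<beta> oo (fps_X ^ 2 * g)))"
proof (rule fps_ext)
  fix n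
  show "fps_nth g n = fps_nth (1 + fps_X * (g * (Abs_fps \<beta> oo (fps_X ^ 2 * g)))) n"
  proof (cases n)
    case 0
    then show ?thesis by (simp add: g0)
  next
    case (Suc m)
    have shift: "fps_nth (g * (fps_X * g) ^ j) (m - j) = fps_nth (g * (fps_X ^ 2 * g) ^ j) m"
      if "j \<le> m" for j
    proof -
      have "(fps_X ^ 2 * g) ^ j = fps_X ^ j * (fps_X * g) ^ j"
        by (simp only: power2_eq_square mult.assoc flip: power_mult_distrib)
      then have "g * (fps_X ^ 2 * g) ^ j = fps_X ^ j * (g * (fps_X * g) ^ j)"
        by (simp only: mult.left_commute)
      then show ?thesis using that by (simp only: fps_X_power_mult_nth) simp
    qed
    have "fps_nth g (Suc m) = (\<Sum>j\<le>m. \<beta> j * fps_nth (g * (fps_X * g) ^ j) (m - j))"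
      using B[unfolded is_B_sequence_def, rule_format, of m 0]
      by (simp add: riordan_entry_def bell_array_def)
    also have "\<dots> = fps_nth (g * (Abs_fps \<beta> oo (fps_X ^ 2 * g))) m"
      by (simp add: fps_mult_compose_nth shift)
    finally show ?thesis using Suc by simp
  qed
qed

lemma catalan_fps_quadratic:
  "catalan_fps = (1 + fps_X * catalan_fps ^ 2 :: 'a::field_char_0 fps)"
proof -
  \<comment> \<open>Expand the square in \<open>catalan_fps_sqrt\<close>; the factor
    \<open>4 * fps_X\<close> then cancels.\<close>
  have "4 * fps_X * (catalan_fps - (1 + fps_X * catalan_fps ^ 2)) = (0 :: 'a fps)"
    using catalan_fps_sqrt[where 'a = 'a] by (simp add: power2_eq_square algebra_simps)
  then show ?thesis by simp
qed

lemma catalan_fps_compose_quadratic: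
  fixes s :: "'a::field_char_0 fps"
  assumes s0: "fps_nth s 0 = 0"
  shows "catalan_fps oo s = 1 + s * (catalan_fps oo s) ^ 2"
  by (subst (1) catalan_fps_quadratic)
    (simp add: fps_compose_add_distrib fps_compose_mult_distrib[OF s0] fps_compose_power[OF s0] s0)

lemma fps_quadratic_root_unique:
  fixes t s :: "'a::field_char_0 fps"
  assumes s0: "fps_nth s 0 = 0" and t0: "fps_nth t 0 = 0" and t: "t = s + t ^ 2"
  shows "t = s * (catalan_fps oo s)"
proof -
  define q where "q = s * (catalan_fps oo s)"
  have q: "q = s + q ^ 2"
    using catalan_fps_compose_quadratic[OF s0] unfolding q_def by algebra
  \<comment> \<open>Subtracting the two quadratics gives this factorization. The second factor has
    constant term 1, so the first must vanish.\<close>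
  have "(t - q) * (1 - (t + q)) = 0"
    using t q by algebra
  moreover have "fps_nth (1 - (t + q)) 0 \<noteq> 0" by (simp add: s0 t0 q_def)
  then have "1 - (t + q) \<noteq> 0" by (metis fps_zero_nth)
  ultimately show ?thesis by (simp add: q_def)
qed

lemma catalan_fps_compose_unique:
  fixes h s :: "'a::field_char_0 fps"
  assumes s0: "fps_nth s 0 = 0" and h: "h = 1 + s * h ^ 2"
  shows "h = catalan_fps oo s"
proof -
  define k where "k = catalan_fps oo s"
  have k: "k = 1 + s * k ^ 2"
    unfolding k_def by (rule catalan_fps_compose_quadratic[OF s0])
  \<comment> \<open>Multiplying the equation for \<open>h\<close> by \<open>s\<close> shows that
    \<open>s * h\<close> solves \<open>t = s + t ^ 2\<close>.\<close>
  have "s * h = s * k"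
    unfolding k_def by (rule fps_quadratic_root_unique[OF s0]) (simp add: s0, use h in algebra)
  \<comment> \<open>As \<open>s\<close> may be zero, it is not cancelled. Instead,
    \<open>s * h = s * k\<close> turns \<open>s * h ^ 2 - s * k ^ 2\<close> into
    \<open>(h - k) * (s * h)\<close>.\<close>
  with h k have "(h - k) * (1 - s * h) = 0" by algebra
  moreover have "fps_nth (1 - s * h) 0 \<noteq> 0" by (simp add: s0)
  then have "1 - s * h \<noteq> 0" by (metis fps_zero_nth)
  ultimately show ?thesis by (simp add: k_def)
qed

text \<open>Composing \<open>fps_X * g\<close> with its inverse \<open>v\<close> gives
  \<open>v * (g oo v) = fps_X\<close>, so the quotient \<open>fps_X / v\<close> is exact.\<close>

lemma A_gf_bell_array:
  fixes g :: "'a::field fps"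
  assumes g0: "fps_nth g 0 = 1"
  defines "v \<equiv> fps_inv (fps_X * g)"
  shows "A_gf (bell_array g) = g oo v" and "v * (g oo v) = fps_X" and "fps_nth v 0 = 0"
proof -
  show v0: "fps_nth v 0 = 0" by (simp add: v_def fps_inv_def)
  have "(fps_X * g) oo v = fps_X"
    unfolding v_def by (rule fps_inv_right) (simp_all add: g0)
  then show v: "v * (g oo v) = fps_X" by (simp add: fps_compose_mult_distrib[OF v0] v0)
  then have "v \<noteq> 0" by auto
  then show "A_gf (bell_array g) = g oo v"
    by (simp add: A_gf_def bell_array_def flip: v_def) (metis v nonzero_mult_div_cancel_left)
qed

theorem proposition2:
  fixes a b c :: complex and g :: "complex fps" and \<beta> :: "nat \<Rightarrow> complex"
  assumes "bell_pseudo_involution g"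
    and "is_B_sequence (bell_array g) \<beta>"
    and "Abs_fps \<beta> = (fps_const a - fps_const c * fps_X) / (1 + fps_const b * fps_X)"
  shows "A_gf (bell_array g) =
           1 + fps_const a * fps_X
           - fps_X ^ 3 * fps_const (a * b + c)
               / (1 + fps_const a * fps_X + fps_const b * fps_X ^ 2)
             * (catalan_fps oo
                 (fps_X ^ 3 * fps_const (a * b + c)
                   / (1 + fps_const a * fps_X + fps_const b * fps_X ^ 2) ^ 2)) \<and>
         g = 1 / (1 - fps_const a * fps_X - fps_const b * fps_X ^ 2)
             * (catalan_fps oo
                 (- (fps_X ^ 2 * (fps_const b + fps_const c * fps_X))
                   / (1 - fps_const a * fps_X - fps_const b * fps_X ^ 2) ^ 2))"
proof -
  define \<a> \<b> \<c> where abc: "\<a> = fps_const a" "\<b> = fps_const b" "\<c> = fps_const c"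
  define X :: "complex fps" where "X = fps_X"
  have g0: "fps_nth g 0 = 1" using assms(1) by (simp add: bell_pseudo_involution_def)
  define u where "u = X ^ 2 * g"
  define B where "B = Abs_fps \<beta> oo u"
  have u0: "fps_nth u 0 = 0" by (simp add: u_def X_def)
  \<comment> \<open>With the denominator cleared, composing with \<open>u\<close> only substitutes
    into polynomials.\<close>
  have "Abs_fps \<beta> * (1 + \<b> * X) = \<a> - \<c> * X"
    unfolding assms(3) abc X_def by (simp add: fps_divide_unit mult.assoc inverse_mult_eq_1)
  from arg_cong[OF this, of "\<lambda>h. h oo u"] have B: "B * (1 + \<b> * u) = \<a> - \<c> * u"
    by (simp add: B_def abc X_def fps_compose_mult_distrib[OF u0] fps_compose_add_distrib
        fps_compose_sub_distrib u0)
  have "g = 1 + X * (g * B)"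
    using bell_B_sequence_functional_eq[OF g0 assms(2)] by (simp add: B_def u_def X_def)
  with B have quad: "g ^ 2 * X ^ 2 * (\<b> + \<c> * X) + g * (1 - \<a> * X - \<b> * X ^ 2) - 1 = 0"
    unfolding u_def by algebra

  \<comment> \<open>\<open>D\<close> is the linear coefficient of \<open>quad\<close>; in terms of
    \<open>D * g\<close> the equation becomes \<open>h = 1 + z * h ^ 2\<close>.\<close>
  define D where "D = 1 - \<a> * X - \<b> * X ^ 2"
  have D: "D * inverse D = 1"
    by (rule inverse_mult_eq_1') (simp add: D_def abc X_def)
  define z where "z = - (X ^ 2 * (\<b> + \<c> * X)) / D ^ 2"
  have z: "z = - (X ^ 2 * (\<b> + \<c> * X)) * inverse D ^ 2"
    unfolding z_def by (subst fps_divide_unit) (simp_all add: D_def abc X_def fps_inverse_power)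
  have "D * g = catalan_fps oo z"
  proof (rule catalan_fps_compose_unique)
    show "fps_nth z 0 = 0" by (simp add: z X_def)
    show "D * g = 1 + z * (D * g) ^ 2"
      using quad D unfolding z D_def[symmetric] by algebra
  qed
  moreover have "1 / D = inverse D"
    by (subst fps_divide_unit) (simp_all add: D_def abc X_def)
  ultimately have g_eq: "g = 1 / D * (catalan_fps oo z)"
    using D by (metis mult.commute mult.left_commute mult.right_neutral)

  define v where "v = fps_inv (X * g)"
  define A where "A = g oo v"
  have A_eq: "A_gf (bell_array g) = A" and vA: "v * A = X" and v0: "fps_nth v 0 = 0"
    using A_gf_bell_array[OF g0] by (simp_all add: A_def v_def X_def)
  have "A ^ 2 * v ^ 2 * (\<b> + \<c> * v) + A * (1 - \<a> * v - \<b> * v ^ 2) - 1 = 0"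
    using arg_cong[OF quad, of "\<lambda>h. h oo v"]
    by (simp add: A_def abc X_def power2_eq_square fps_compose_mult_distrib[OF v0]
        fps_compose_add_distrib fps_compose_sub_distrib v0)
  \<comment> \<open>The extra factor \<open>A\<close> lets every \<open>v\<close> be paired with an
    \<open>A\<close>, and \<open>v * A = X\<close> then eliminates \<open>v\<close>.\<close>
  then have "A * (A ^ 2 * v ^ 2 * (\<b> + \<c> * v) + A * (1 - \<a> * v - \<b> * v ^ 2) - 1) = 0"
    by simp
  then have A_quad: "A ^ 2 + A * (\<b> * X ^ 2 - \<a> * X - 1) + \<c> * X ^ 3 - \<b> * X ^ 2 = 0"
    unfolding vA[symmetric] by (simp add: power2_eq_square power3_eq_cube algebra_simps)

  \<comment> \<open>Put \<open>w = 1 + \<a> * X - A\<close>. Then \<open>A_quad\<close> reads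
    \<open>w ^ 2 - P * w + e * X ^ 3 = 0\<close>, and dividing by \<open>P ^ 2\<close> gives
    \<open>t = s + t ^ 2\<close> for \<open>t = w / P\<close>.\<close>
  define P where "P = 1 + \<a> * X + \<b> * X ^ 2"
  define e where "e = \<a> * \<b> + \<c>"
  have P: "P * inverse P = 1"
    by (rule inverse_mult_eq_1') (simp add: P_def abc X_def)
  define s where "s = X ^ 3 * e / P ^ 2"
  have s: "s = X ^ 3 * e * inverse P ^ 2"
    unfolding s_def by (subst fps_divide_unit) (simp_all add: P_def abc X_def fps_inverse_power)
  have "(1 + \<a> * X - A) * inverse P = s * (catalan_fps oo s)"
  proof (rule fps_quadratic_root_unique)
    show "fps_nth s 0 = 0" by (simp add: s X_def)
    \<comment> \<open>The constant term of \<open>A\<close> is that of \<open>g\<close>, namely 1;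
      this selects the root.\<close>
    show "fps_nth ((1 + \<a> * X - A) * inverse P) 0 = 0"
      by (simp add: A_def X_def g0)
    show "(1 + \<a> * X - A) * inverse P = s + ((1 + \<a> * X - A) * inverse P) ^ 2"
      using A_quad P P_def unfolding s e_def by algebra
  qed
  moreover have "X ^ 3 * e / P = X ^ 3 * e * inverse P"
    by (subst fps_divide_unit) (simp_all add: P_def abc X_def)
  ultimately have "A_gf (bell_array g) = 1 + \<a> * X - X ^ 3 * e / P * (catalan_fps oo s)"
    using P unfolding s A_eq by algebra
  moreover have "e = fps_const (a * b + c)"
    by (simp add: e_def abc)
  ultimately show ?thesis
    using g_eq unfolding s_def z_def P_def D_def abc X_def by blast
qed

end
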